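(* For any composition $\alpha$ of $n$, with $W=\mathfrak S_n$, $$\left[\begin{matrix} n\\\alpha\end{matrix}\right]_{q,t}=\sum_{w\in W^\alpha}\mathrm{wt}(w;q,t)$$ in $\hat{\mathbb Q}(\mathbf t)$.
   Context: Ring: $\hat{\mathbb Q}(\mathbf t)$ is the field of rational functions over $\mathbb Q$ in algebraically independent indeterminates denoted $t^{q^r}$, $r\in\mathbb Z$ ($t=t^{q^0}$; $q$ is a formal symbol). For $f(q)=\sum_rc_rq^r$ write $t^{f(q)}:=\prod_r(t^{q^r})^{c_r}$. The automorphism $\varphi$ sends $t^{q^r}\mapsto t^{q^{r+1}}$, and $F(q,t^{q^m}):=\varphi^mF(q,t)$. Put $n!_{q,t}:=\prod_{i=0}^{n-1}(1-t^{q^n-q^i})$. Multinomial: for $\alpha=(\alpha_1,\ldots,\alpha_\ell)$ with $\sigma_s=\alpha_1+\cdots+\alpha_s$, $\sigma_0=0$, $\sigma_\ell=n$, $$\left[\begin{matrix} n\\\alpha\end{matrix}\right]_{q,t}:=\frac{n!_{q,t}}{\alpha!_{q,t}},\qquad\alpha!_{q,t}:=\prod_{s=1}^{\ell}\alpha_s!_{q,t^{q^{\sigma_{s-1}}}}.$$ $W^\alpha$ is the set of minimum-length coset representatives for $W/W_\alpha$, i.e. the set of $w\in\mathfrak S_n$ such that $w(i)>w(i+1)$ implies $i\in\{\sigma_1,\ldots,\sigma_{\ell-1}\}$ (equivalently $\alpha$ refines the descent composition of $w$, which lists the lengths of the maximal increasing consecutive runs of $w(1),\ldots,w(n)$). The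 permutations $u_\lambda$: for a partition $\lambda$ inside a $k\times(n-k)$ rectangle, $u_\lambda\in\mathfrak S_n$ is the permutation increasing on $\{1,\ldots,k\}$ and on $\{k+1,\ldots,n\}$ with $u_\lambda(i)=\lambda_{k+1-i}+i$ for $i=1,\ldots,k$. Weight: $\mathrm{wt}(w;q,t)\in\hat{\mathbb Q}(\mathbf t)$ for $w\in\mathfrak S_n$ is defined recursively: it is $1$ if $n\le1$. Otherwise let $w^{-1}(1)=k+1$ and factor uniquely $w=u_\lambda\cdot a\cdot e\cdot b$ (so $w(i)=u_\lambda(a(i))$ for $i\le k$, etc.) with $\lambda$ inside a $k\times(n-k)$ rectangle, $a\in\mathfrak S_{\{1,\ldots,k\}}\cong\mathfrak S_k$, $e$ the identity on $\{k+1\}$, and $b\in\mathfrak S_{\{k+2,\ldots,n\}}\cong\mathfrak S_{n-k-1}$. Here $\lambda$ has exactly $k$ nonzero parts; let $\hat\lambda=(\lambda_1-1,\ldots,\lambda_k-1)$, inside a $k\times(n-1-k)$ rectangle, so $u_{\hat\lambda}\in\mathfrak S_{n-1}$. Set $$\mathrm{wt}(w;q,t):=t^{q^k-1}\frac{k!_{q,t^q}}{k!_{q,t}}\cdot\mathrm{wt}(u_{\hat\lambda};q,t^q)\,\mathrm{wt}(a;q,t)\,\mathrm{wt}(b;q,t^{q^{k+1}}).$$ *)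

theory Defs
  imports Complex_Main
    "HOL-Library.Poly_Mapping"
    "HOL-Computational_Algebra.Fraction_Field"
    "HOL-Combinatorics.Permutations"
begin

section \<open>The field and its automorphism\<close>

text \<open>
  \<^typ>\<open>int \<Rightarrow>\<^sub>0 nat\<close> is the type of monomials in indeterminates indexed by the integers, where the
  indeterminate with index \<open>r\<close> plays the role of \<open>t^(q^r)\<close>.
\<close>

type_synonym qpoly = "(int \<Rightarrow>\<^sub>0 nat) \<Rightarrow>\<^sub>0 rat"
type_synonym qfield = "qpoly fract"

definition var :: "int \<Rightarrow> qfield" where
  "var r = Fract (Poly_Mapping.single (Poly_Mapping.single r 1) 1) 1"

text \<open>
  \<open>Poly_Mapping.map_key\<close> acts by precomposition, so \<open>r \<mapsto> r + 1\<close> on the indices of the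
  indeterminates is \<open>map_key (\<lambda>r. r - 1)\<close> on monomials; on polynomials one
  precomposes with the inverse map on monomials.
\<close>

definition shift_poly :: "qpoly \<Rightarrow> qpoly" where
  "shift_poly p = Poly_Mapping.map_key (Poly_Mapping.map_key (\<lambda>r. r + 1)) p"

lemma map_key_up_down:
  "Poly_Mapping.map_key (\<lambda>r::int. r + 1) (Poly_Mapping.map_key (\<lambda>r. r - 1) e) = e"
  "Poly_Mapping.map_key (\<lambda>r::int. r - 1) (Poly_Mapping.map_key (\<lambda>r. r + 1) e) = e"
  by (auto intro!: poly_mapping_eqI simp: map_key.rep_eq inj_on_def)

lemma inj_map_key_up: "inj (Poly_Mapping.map_key (\<lambda>r::int. r + 1))"
  by (rule inj_on_inverseI, rule map_key_up_down(2))

lemma shift_poly_single: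
  "shift_poly (Poly_Mapping.single e c) =
     Poly_Mapping.single (Poly_Mapping.map_key (\<lambda>r. r - 1) e) c"
  unfolding shift_poly_def
  by (subst map_key_single[OF inj_map_key_up, symmetric]) (simp add: map_key_up_down)

lemma shift_poly_0 [simp]: "shift_poly 0 = 0"
  by (simp add: shift_poly_def inj_map_key_up)

lemma shift_poly_1 [simp]: "shift_poly 1 = 1"
  by (simp add: shift_poly_single inj_on_def flip: single_one)

lemma shift_poly_add: "shift_poly (p + p') = shift_poly p + shift_poly p'"
  by (simp add: shift_poly_def map_key_plus inj_map_key_up)

lemma qpoly_induct [case_names zero single add]:
  fixes p :: qpoly
  assumes "P 0" "\<And>e c. P (Poly_Mapping.single e c)" "\<And>p p'. P p \<Longrightarrow> P p' \<Longrightarrow> P (p + p')"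
  shows "P p"
proof (induction p rule: update_induct)
  case const
  show ?case by (fact assms(1))
next
  case (update f a b)
  have "Poly_Mapping.update a b f = f + Poly_Mapping.single a b"
    using update(1)
    by (intro poly_mapping_eqI)
       (auto simp: lookup_update lookup_add lookup_single when_def in_keys_iff)
  then show ?case
    using assms update by simp
qed

lemma shift_poly_mult: "shift_poly (p * p') = shift_poly p * shift_poly p'"
proof (induction p rule: qpoly_induct)
  case (single e c)
  show ?case
    by (induction p' rule: qpoly_induct)
       (simp_all add: shift_poly_single shift_poly_add mult_single map_key_plus inj_on_def algebra_simps)
qed (simp_all add: shift_poly_add algebra_simps)

lemma shift_poly_eq_0_iff [simp]: "shift_poly p = 0 \<longleftrightarrow> p = 0"
proof
  assume *: "shift_poly p = 0"
  show "p = 0"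
  proof (rule poly_mapping_eqI)
    fix e
    have "Poly_Mapping.lookup (shift_poly p) (Poly_Mapping.map_key (\<lambda>r. r - 1) e) =
          Poly_Mapping.lookup p e"
      by (simp add: shift_poly_def map_key.rep_eq inj_map_key_up map_key_up_down)
    then show "Poly_Mapping.lookup p e = Poly_Mapping.lookup 0 e"
      using * by simp
  qed
qed simp

lift_definition phi :: "qfield \<Rightarrow> qfield" is "\<lambda>(a, b). (shift_poly a, shift_poly b)"
  by (auto simp flip: shift_poly_mult)

lemma phi_Fract: "phi (Fract a b) = Fract (shift_poly a) (shift_poly b)"
  by transfer auto

lemma phi_add: "phi (x + y) = phi x + phi y"
  by (cases x, cases y) (simp add: phi_Fract shift_poly_add shift_poly_mult)

lemma phi_mult: "phi (x * y) = phi x * phi y"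
  by (cases x, cases y) (simp add: phi_Fract shift_poly_mult)

lemma phi_0 [simp]: "phi 0 = 0" and phi_1 [simp]: "phi 1 = 1"
  by (simp_all add: Zero_fract_def One_fract_def phi_Fract)

lemma phi_var: "phi (var r) = var (r + 1)"
proof -
  have "Poly_Mapping.map_key (\<lambda>s. s - 1) (Poly_Mapping.single r (1::nat)) =
        Poly_Mapping.single (r + 1) 1"
    using map_key_single[of "\<lambda>s::int. s - 1" "r + 1" "1::nat"] by (simp add: inj_on_def)
  then show ?thesis
    by (simp add: var_def phi_Fract shift_poly_single)
qed

section \<open>Factorials and multinomials\<close>

text \<open>\<open>tpow f\<close> is \<open>t^f(q)\<close>, where \<open>f\<close> is the finitely supported family of integer coefficients of \<open>f(q)\<close>.\<close>

definition tpow :: "(int \<Rightarrow>\<^sub>0 int) \<Rightarrow> qfield" where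
  "tpow f = (\<Prod>r\<in>Poly_Mapping.keys f. var r powi Poly_Mapping.lookup f r)"

definition qpow :: "nat \<Rightarrow> (int \<Rightarrow>\<^sub>0 int)" where
  "qpow m = Poly_Mapping.single (int m) 1"

definition qtfact :: "nat \<Rightarrow> qfield" where
  "qtfact n = (\<Prod>i<n. 1 - tpow (qpow n - qpow i))"

definition composition :: "nat \<Rightarrow> nat list \<Rightarrow> bool" where
  "composition n \<alpha> \<longleftrightarrow> (\<forall>x\<in>set \<alpha>. 0 < x) \<and> sum_list \<alpha> = n"

definition psum :: "nat list \<Rightarrow> nat \<Rightarrow> nat" where
  "psum \<alpha> s = sum_list (take s \<alpha>)"

text \<open>List indices start at 0, so \<open>\<alpha> ! s\<close> is the part \<open>\<alpha>\<^sub>s\<^sub>+\<^sub>1\<close>, and it is paired with \<open>\<sigma>\<^sub>s\<close>.\<close>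

definition qtfact_comp :: "nat list \<Rightarrow> qfield" where
  "qtfact_comp \<alpha> = (\<Prod>s<length \<alpha>. (phi ^^ psum \<alpha> s) (qtfact (\<alpha> ! s)))"

definition qtmultinomial :: "nat \<Rightarrow> nat list \<Rightarrow> qfield" where
  "qtmultinomial n \<alpha> = qtfact n / qtfact_comp \<alpha>"

section \<open>Permutations\<close>

text \<open>Elements of \<open>\<SS>\<^sub>n\<close> are functions on the naturals that permute \<open>{1..n}\<close> and fix everything else.\<close>

definition min_coset_reps :: "nat \<Rightarrow> nat list \<Rightarrow> (nat \<Rightarrow> nat) set" where
  "min_coset_reps n \<alpha> =
     {w. w permutes {1..n} \<and> (\<forall>i\<in>{1..<n}. w i > w (i + 1) \<longrightarrow> i \<in> psum \<alpha> ` {1..<length \<alpha>})}"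

text \<open>
  A partition inside a \<open>k \<times> m\<close> rectangle is a list of exactly \<open>k\<close> parts, padded with zeros;
  \<open>l ! (k - i)\<close> is the part \<open>\<lambda>\<^sub>k\<^sub>+\<^sub>1\<^sub>-\<^sub>i\<close>.
\<close>

definition partition_in :: "nat \<Rightarrow> nat \<Rightarrow> nat list \<Rightarrow> bool" where
  "partition_in k m l \<longleftrightarrow> length l = k \<and> sorted_wrt (\<ge>) l \<and> (\<forall>x\<in>set l. x \<le> m)"

definition is_u :: "nat \<Rightarrow> nat list \<Rightarrow> (nat \<Rightarrow> nat) \<Rightarrow> bool" where
  "is_u n l u \<longleftrightarrow>
     (let k = length l in
        u permutes {1..n} \<and> strict_mono_on {1..k} u \<and> strict_mono_on {k+1..n} u \<and>
        (\<forall>i\<in>{1..k}. u i = l ! (k - i) + i))"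

definition u_perm :: "nat \<Rightarrow> nat list \<Rightarrow> nat \<Rightarrow> nat" where
  "u_perm n l = (THE u. is_u n l u)"

definition wt_factor :: "nat \<Rightarrow> (nat \<Rightarrow> nat) \<Rightarrow> nat list \<times> (nat \<Rightarrow> nat) \<times> (nat \<Rightarrow> nat)" where
  "wt_factor n w =
     (let k = inv w 1 - 1 in
        THE (l, a, b). partition_in k (n - k) l \<and> a permutes {1..k} \<and> b permutes {k+2..n} \<and>
          w = u_perm n l \<circ> a \<circ> b)"

text \<open>The isomorphism from permutations of \<open>{d+1..}\<close> to permutations of \<open>{1..}\<close>.\<close>

definition relabel :: "nat \<Rightarrow> (nat \<Rightarrow> nat) \<Rightarrow> nat \<Rightarrow> nat" where
  "relabel d b i = b (i + d) - d"

section \<open>The weight\<close>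

text \<open>The final \<open>else\<close> branch is a dummy value for functions that are not permutations of \<open>{1..n}\<close>.\<close>

function wt :: "nat \<Rightarrow> (nat \<Rightarrow> nat) \<Rightarrow> qfield" where
  "wt n w =
     (if n \<le> 1 then 1
      else if w permutes {1..n} then
        (let k = inv w 1 - 1; (l, a, b) = wt_factor n w in
           tpow (qpow k - qpow 0) * (phi (qtfact k) / qtfact k) *
           phi (wt (n - 1) (u_perm (n - 1) (map (\<lambda>x. x - 1) l))) *
           wt k a *
           (phi ^^ (k + 1)) (wt (n - k - 1) (relabel (k + 1) b)))
      else 0)"
  by pat_completeness auto
termination
proof (relation "measure fst", goal_cases)
  case (3 n w k p l p' a b)
  then have "inv w 1 \<in> {1..n}"
    using permutes_in_image[OF permutes_inv[of w "{1..n}"], of 1] by simp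
  with 3 show ?case by auto
qed auto

declare wt.simps [simp del]

end

theory Submission
  imports Defs "HOL-Library.Infinite_Set"
begin

text \<open>
  Sort the permutations \<open>w\<close> by the position \<open>k + 1\<close> of the value \<open>1\<close>. If \<open>w\<close> may descend only at
  places of a set \<open>D\<close>, then \<open>k = 0\<close> or \<open>k \<in> D\<close>, because the entry in front of a \<open>1\<close> is always larger.
  In the factorisation \<open>w = u\<^sub>\<lambda> a b\<close> that defines the weight, \<open>a\<close> and \<open>b\<close> carry the descents of
  \<open>w\<close> to the left and to the right of the \<open>1\<close>, while \<open>\<lambda>\<close> is any partition without zero parts
  (lemma \<open>descents_factor\<close>).
  Taking one off every part of \<open>\<lambda>\<close> leaves an arbitrary partition in a \<open>k \<times> (n - 1 - k)\<close> rectangle,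
  that is, an arbitrary permutation of \<open>{1..n - 1}\<close> with no descent except possibly at \<open>k\<close>. Hence,
  for each \<open>k\<close>, the weights of these \<open>w\<close> add up to a coefficient times a product of three sums of the
  same kind for smaller \<open>n\<close> (lemma \<open>sum_perms_desc_rec\<close>).

  When \<open>D\<close> is the set of partial sums of \<open>\<alpha>\<close>, the admissible \<open>k\<close> are the \<open>\<sigma>\<^sub>s\<close> with
  \<open>0 \<le> s < \<ell>\<close>. By induction, the three smaller sums are the multinomials of
  \<open>(k, n - 1 - k)\<close>, of \<open>(\<alpha>\<^sub>1, \<dots>, \<alpha>\<^sub>s)\<close> and of \<open>(\<alpha>\<^sub>s\<^sub>+\<^sub>1 - 1, \<alpha>\<^sub>s\<^sub>+\<^sub>2, \<dots>)\<close>.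
  Writing \<open>x\<^sub>i\<close> for the indeterminate \<open>t\<close> to the power \<open>q\<close> to the \<open>i\<close>, nearly all factors of their
  product cancel, and the contribution of \<open>s\<close> is the multinomial of \<open>\<alpha>\<close> times
  \<open>(x\<^bsub>\<sigma>(s)\<^esub> - x\<^bsub>\<sigma>(s+1)\<^esub>) / (x\<^bsub>0\<^esub> - x\<^bsub>n\<^esub>)\<close> (lemma \<open>qtmultinomial_split\<close>).
  These fractions telescope to \<open>1\<close>.

  The parts \<open>n - 1 - k\<close> and \<open>\<alpha>\<^sub>s\<^sub>+\<^sub>1 - 1\<close> may vanish, so the induction runs over lists that may contain
  zeros. A zero part of \<open>\<alpha>\<close> repeats a partial sum and contributes \<open>0\<close> to the telescoping sum.
\<close>

section \<open>The field automorphism and the factorials\<close>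

abbreviation tq :: "nat \<Rightarrow> qfield" where
  "tq i \<equiv> var (int i)"

lemma var_eq_iff: "var r = var s \<longleftrightarrow> r = s"
proof
  assume "var r = var s"
  then have "Poly_Mapping.single (Poly_Mapping.single r (1::nat)) (1::rat) =
      Poly_Mapping.single (Poly_Mapping.single s 1) 1"
    by (simp add: var_def eq_fract)
  then have "Poly_Mapping.single r (1::nat) = Poly_Mapping.single s 1"
    by (metis lookup_single_eq lookup_single_not_eq one_neq_zero)
  then show "r = s"
    by (metis lookup_single_eq lookup_single_not_eq one_neq_zero)
qed simp

lemma var_nonzero: "var r \<noteq> 0"
  by (simp add: var_def Zero_fract_def eq_fract)
     (metis lookup_single_eq lookup_zero one_neq_zero)

lemma tpow_qpow_diff: "tpow (qpow a - qpow b) = tq a / tq b"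
proof (cases "a = b")
  case True
  then show ?thesis by (simp add: tpow_def var_nonzero)
next
  case False
  let ?f = "qpow a - qpow b"
  have "Poly_Mapping.lookup ?f r = (if r = int a then 1 else if r = int b then - 1 else 0)" for r
    using False by (auto simp: qpow_def lookup_minus lookup_single when_def)
  moreover from this have "Poly_Mapping.keys ?f = {int a, int b}"
    by (auto simp: in_keys_iff split: if_splits)
  ultimately show ?thesis
    using False by (simp add: tpow_def power_int_minus divide_inverse)
qed

lemma phi_uminus: "phi (- x) = - phi x"
  by (metis add.right_inverse eq_neg_iff_add_eq_0 phi_0 phi_add)

lemma phi_diff: "phi (x - y) = phi x - phi y"
  by (metis diff_conv_add_uminus phi_add phi_uminus)

lemma phi_eq_0_iff: "phi x = 0 \<longleftrightarrow> x = 0"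
  by (metis mult_zero_left phi_0 phi_1 phi_mult right_inverse zero_neq_one)

lemma phi_divide: "phi (x / y) = phi x / phi y"
  by (metis div_by_0 nonzero_eq_divide_eq phi_0 phi_eq_0_iff phi_mult)

lemma phi_sum: "phi (sum f A) = (\<Sum>x\<in>A. phi (f x))"
  by (induction A rule: infinite_finite_induct) (auto simp: phi_add)

lemma phi_prod: "phi (prod f A) = (\<Prod>x\<in>A. phi (f x))"
  by (induction A rule: infinite_finite_induct) (auto simp: phi_mult)

lemma phi_pow_mult: "(phi ^^ m) (x * y) = (phi ^^ m) x * (phi ^^ m) y"
  by (induction m) (auto simp: phi_mult)

lemma phi_pow_divide: "(phi ^^ m) (x / y) = (phi ^^ m) x / (phi ^^ m) y"
  by (induction m) (auto simp: phi_divide)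

lemma phi_pow_diff: "(phi ^^ m) (x - y) = (phi ^^ m) x - (phi ^^ m) y"
  by (induction m) (auto simp: phi_diff)

lemma phi_pow_sum: "(phi ^^ m) (sum f A) = (\<Sum>x\<in>A. (phi ^^ m) (f x))"
  by (induction m) (auto simp: phi_sum)

lemma phi_pow_prod: "(phi ^^ m) (prod f A) = (\<Prod>x\<in>A. (phi ^^ m) (f x))"
  by (induction m) (auto simp: phi_prod)

lemma phi_pow_1: "(phi ^^ m) 1 = 1"
  by (induction m) auto

lemma phi_pow_eq_0_iff: "(phi ^^ m) x = 0 \<longleftrightarrow> x = 0"
  by (induction m) (auto simp: phi_eq_0_iff)

lemma phi_pow_tq: "(phi ^^ m) (tq i) = tq (i + m)"
  by (induction m) (auto simp: phi_var algebra_simps)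

lemma qtfact_nonzero: "qtfact n \<noteq> 0"
  by (auto simp: qtfact_def tpow_qpow_diff var_nonzero var_eq_iff)

lemma qtfact_0: "qtfact 0 = 1"
  by (simp add: qtfact_def)

text \<open>
  Shifting \<open>q^i\<close> to \<open>q^(i+1)\<close> turns the factors of the \<open>n\<close>-th factorial into all factors of the next
  one except the factor for \<open>i = 0\<close>.
\<close>
lemma qtfact_Suc: "qtfact (Suc n) = (1 - tq (Suc n) / tq 0) * phi (qtfact n)"
proof -
  have "phi (tpow (qpow n - qpow i)) = tpow (qpow (Suc n) - qpow (Suc i))" for i
    using phi_pow_tq[of 1] by (simp add: tpow_qpow_diff phi_divide)
  then have "phi (qtfact n) = (\<Prod>i<n. 1 - tpow (qpow (Suc n) - qpow (Suc i)))"
    by (simp add: qtfact_def phi_prod phi_diff)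
  then show ?thesis
    by (simp add: qtfact_def prod.lessThan_Suc_shift tpow_qpow_diff del: prod.lessThan_Suc)
qed

lemma psum_Cons_Suc: "psum (x # xs) (Suc s) = x + psum xs s"
  by (simp add: psum_def)

lemma qtfact_comp_Nil: "qtfact_comp [] = 1"
  by (simp add: qtfact_comp_def)

lemma qtfact_comp_Cons: "qtfact_comp (x # xs) = qtfact x * (phi ^^ x) (qtfact_comp xs)"
proof -
  have "qtfact_comp (x # xs) =
      qtfact x * (\<Prod>s<length xs. (phi ^^ (x + psum xs s)) (qtfact (xs ! s)))"
    unfolding qtfact_comp_def
    by (simp add: prod.lessThan_Suc_shift psum_Cons_Suc psum_def del: prod.lessThan_Suc)
  then show ?thesis
    by (simp add: qtfact_comp_def phi_pow_prod funpow_add)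
qed

lemma qtfact_comp_append:
  "qtfact_comp (xs @ ys) = qtfact_comp xs * (phi ^^ sum_list xs) (qtfact_comp ys)"
  by (induction xs)
     (simp_all add: qtfact_comp_Nil qtfact_comp_Cons phi_pow_mult funpow_add mult.assoc)

lemma qtfact_comp_nonzero: "qtfact_comp xs \<noteq> 0"
  by (induction xs)
     (simp_all add: qtfact_comp_Nil qtfact_comp_Cons qtfact_nonzero phi_pow_eq_0_iff)

text \<open>
  The algebra behind the theorem, for one block of length \<open>m\<close> preceded by \<open>k\<close> places. The factorial of
  \<open>k\<close>, its image under \<^const>\<open>phi\<close> and the shifted factorial of \<open>n - k - 1\<close> each occur once in a numerator and
  once in a denominator. Besides the power of \<open>t\<close>, what remains is \<open>phi (qtfact (n - 1))\<close>
  over the factorial of the composition with the block \<open>m\<close> shortened by its first place, and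
  \<open>qtfact_Suc\<close> restores the full factorials of \<open>n\<close> and of \<open>m\<close> at the cost of the last fraction.
\<close>
lemma qtmultinomial_split:
  assumes k: "k = sum_list xs" and n: "n = k + m + sum_list ys" and m: "0 < m"
  shows "tpow (qpow k - qpow 0) * (phi (qtfact k) / qtfact k) *
      phi (qtmultinomial (n - 1) [k, n - 1 - k]) * qtmultinomial k xs *
      (phi ^^ (k + 1)) (qtmultinomial (n - k - 1) ((m - 1) # ys)) =
    qtmultinomial n (xs @ m # ys) * ((tq k - tq (k + m)) / (tq 0 - tq n))"
proof -
  obtain m' where m': "m = Suc m'" using m by (cases m) auto
  define N where "N = n - 1"
  have N: "n = Suc N" using n m' by (simp add: N_def)
  have m1: "m - 1 = m'" using m' by simp
  have n': "n - k - 1 = N - k" using N by simp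
  define F where "F = phi (qtfact N)"
  define K where "K = qtfact k"
  define K' where "K' = phi (qtfact k)"
  define G where "G = (phi ^^ (k + 1)) (qtfact (N - k))"
  define H where "H = (phi ^^ (k + 1)) (qtfact m')"
  define C where "C = qtfact_comp xs"
  define D where "D = (phi ^^ (k + m)) (qtfact_comp ys)"
  have nz: "F \<noteq> 0" "K \<noteq> 0" "K' \<noteq> 0" "G \<noteq> 0" "H \<noteq> 0" "C \<noteq> 0" "D \<noteq> 0"
    unfolding F_def K_def K'_def G_def H_def C_def D_def
    by (simp_all only: phi_pow_eq_0_iff phi_eq_0_iff qtfact_nonzero qtfact_comp_nonzero not_False_eq_True)
  have tnz: "tq 0 \<noteq> 0" "tq k \<noteq> 0" "tq n \<noteq> tq 0"
    using N unfolding var_eq_iff by (auto simp: var_nonzero)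
  have e1: "phi (qtmultinomial N [k, N - k]) = F / (K' * G)"
    by (simp add: qtmultinomial_def qtfact_comp_Cons qtfact_comp_Nil phi_pow_1 phi_divide
        phi_mult F_def K'_def G_def)
  have e2: "(phi ^^ (k + 1)) (qtmultinomial (N - k) (m' # ys)) = G / (H * D)"
  proof -
    have "(phi ^^ (k + 1)) ((phi ^^ m') (qtfact_comp ys)) = D"
      by (simp add: D_def m' funpow_add)
    then show ?thesis
      by (simp only: qtmultinomial_def qtfact_comp_Cons phi_pow_divide phi_pow_mult G_def H_def)
  qed
  have e3: "qtmultinomial k xs = K / C"
    by (simp add: qtmultinomial_def K_def C_def)
  have e4: "(phi ^^ k) (qtfact m) = (1 - tq (k + m) / tq k) * H"
  proof -
    have "(phi ^^ k) (phi (qtfact m')) = H"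
      by (simp add: H_def funpow_swap1)
    then show ?thesis
      by (simp only: m' qtfact_Suc phi_pow_mult phi_pow_diff phi_pow_divide phi_pow_1 phi_pow_tq)
         (simp add: add.commute)
  qed
  have e5: "qtmultinomial n (xs @ m # ys) =
      (1 - tq n / tq 0) * F / (C * (((1 - tq (k + m) / tq k) * H) * D))"
    unfolding qtmultinomial_def qtfact_comp_append qtfact_comp_Cons phi_pow_mult
      k[symmetric] e4
    by (simp add: N qtfact_Suc F_def C_def D_def funpow_add)
  have km: "tq k \<noteq> tq (k + m)" using m unfolding var_eq_iff by simp
  have alg: "u / z * (K' / K) * (F / (K' * G)) * (K / C) * (G / (H * D)) =
      (1 - v / z) * F / (C * (((1 - w / u) * H) * D)) * ((u - w) / (z - v))"
    if "u \<noteq> 0" "z \<noteq> 0" "u \<noteq> w" "z \<noteq> v" for u v w z :: qfield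
  proof -
    have 1: "1 - v / z = (z - v) / z" "1 - w / u = (u - w) / u"
      using that by (simp_all add: diff_divide_distrib)
    have 2: "z - v \<noteq> 0" "u - w \<noteq> 0" using that by auto
    show ?thesis unfolding 1 using nz that(1,2) 2 by (simp add: mult_ac)
  qed
  show ?thesis
    unfolding n' N_def[symmetric] m1 e1 e2 e3 e5 tpow_qpow_diff K'_def[symmetric]
    unfolding K_def[symmetric]
    by (rule alg) (use tnz km in auto)
qed

section \<open>Permutations with prescribed descents and Grassmannian permutations\<close>

definition perms_desc :: "nat \<Rightarrow> nat set \<Rightarrow> (nat \<Rightarrow> nat) set" where
  "perms_desc n D = {w. w permutes {1..n} \<and> (\<forall>i\<in>{1..<n}. w i > w (i + 1) \<longrightarrow> i \<in> D)}"

lemma finite_perms_desc: "finite (perms_desc n D)"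
  by (rule finite_subset[OF _ finite_permutations[of "{1..n}"]]) (auto simp: perms_desc_def)

lemma perms_desc_cong:
  assumes "\<And>i. 1 \<le> i \<Longrightarrow> i < n \<Longrightarrow> i \<in> D \<longleftrightarrow> i \<in> D'"
  shows "perms_desc n D = perms_desc n D'"
  using assms by (auto simp: perms_desc_def)

lemma strict_mono_on_intervalI:
  fixes f :: "nat \<Rightarrow> nat"
  assumes step: "\<And>i. a \<le> i \<Longrightarrow> i < b \<Longrightarrow> f i < f (Suc i)"
  shows "strict_mono_on {a..b} f"
proof (rule strict_mono_onI)
  fix i j assume "i \<in> {a..b}" "j \<in> {a..b}" "i < j"
  have "i + Suc d \<le> b \<Longrightarrow> f i < f (i + Suc d)" for d
  proof (induction d)
    case 0
    then show ?case using step[of i] \<open>i \<in> {a..b}\<close> by simp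
  next
    case (Suc d)
    then show ?case using step[of "i + Suc d"] \<open>i \<in> {a..b}\<close> by simp
  qed
  from this[of "j - i - 1"] show "f i < f j"
    using \<open>i < j\<close> \<open>j \<in> {a..b}\<close> by simp
qed

lemma perms_desc_singleton:
  "perms_desc n {k} =
    {u. u permutes {1..n} \<and> strict_mono_on {1..k} u \<and> strict_mono_on {k + 1..n} u}"
    if "k \<le> n"
proof (intro set_eqI iffI)
  fix u assume u: "u \<in> perms_desc n {k}"
  then have "u permutes {1..n}" by (simp add: perms_desc_def)
  then have "u i \<noteq> u (Suc i)" for i by (simp add: inj_eq permutes_inj)
  then have "u i < u (Suc i)" if "1 \<le> i" "i < n" "i \<noteq> k" for i
    using u that unfolding perms_desc_def by (fastforce simp: not_less le_less)
  then show "u \<in> {u. u permutes {1..n} \<and> strict_mono_on {1..k} u \<and> strict_mono_on {k + 1..n} u}"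
    using \<open>u permutes {1..n}\<close> \<open>k \<le> n\<close> by (auto intro!: strict_mono_on_intervalI)
next
  fix u
  assume u: "u \<in> {u. u permutes {1..n} \<and> strict_mono_on {1..k} u \<and> strict_mono_on {k + 1..n} u}"
  have "i \<in> {k}" if "i \<in> {1..<n}" "u (i + 1) < u i" for i
  proof (rule ccontr)
    assume "i \<notin> {k}"
    then have "u i < u (i + 1)"
      using u that(1) strict_mono_onD[of "{1..k}" u i "i + 1"]
        strict_mono_onD[of "{k + 1..n}" u i "i + 1"]
      by (cases "i < k") auto
    then show False using that(2) by simp
  qed
  then show "u \<in> perms_desc n {k}" using u by (auto simp: perms_desc_def)
qed

text \<open>
  Both functions list the elements of the same finite set in increasing order.
\<close>
lemma strict_mono_on_interval_unique:
  fixes f g :: "nat \<Rightarrow> nat"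
  assumes "strict_mono_on {a..<b} f" "strict_mono_on {a..<b} g" "f ` {a..<b} = g ` {a..<b}"
    and "i \<in> {a..<b}"
  shows "f i = g i"
proof -
  have *: "sorted (map h [a..<b]) \<and> distinct (map h [a..<b])"
    if "strict_mono_on {a..<b} h" for h :: "nat \<Rightarrow> nat"
    using strict_mono_on_imp_inj_on[OF that] strict_mono_onD[OF that]
    by (auto simp: distinct_map sorted_iff_nth_mono_less less_imp_le)
  have "map f [a..<b] = map g [a..<b]"
    by (rule sorted_distinct_set_unique) (use assms * in auto)
  then show ?thesis using assms(4) by auto
qed

text \<open>
  Such a permutation lists a \<open>k\<close>-element set in increasing order and then its complement in
  increasing order, so the set determines it.
\<close>
lemma grassmannian_eqI:
  assumes u: "u \<in> perms_desc n {k}" and v: "v \<in> perms_desc n {k}" and k: "k \<le> n"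
    and eq: "u ` {1..k} = v ` {1..k}"
  shows "u = v"
proof
  fix i
  note uv = u[unfolded perms_desc_singleton[OF k]] v[unfolded perms_desc_singleton[OF k]]
  have compl: "w ` {k + 1..n} = {1..n} - w ` {1..k}" if "w permutes {1..n}" for w
  proof -
    have "{k + 1..n} = {1..n} - {1..k}" by auto
    then show ?thesis
      using that by (simp add: image_set_diff permutes_inj permutes_image)
  qed
  have ivl: "{1..k} = {1..<k + 1}" "{k + 1..n} = {k + 1..<n + 1}" by auto
  consider "i \<in> {1..k}" | "i \<in> {k + 1..n}" | "i \<notin> {1..n}" by fastforce
  then show "u i = v i"
  proof cases
    case 1
    then show ?thesis
      using uv eq strict_mono_on_interval_unique[of 1 "k + 1" u v i] unfolding ivl by blast
  next
    case 2
    have "u ` {k + 1..n} = v ` {k + 1..n}" using uv eq compl by simp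
    then show ?thesis
      using uv 2 strict_mono_on_interval_unique[of "k + 1" "n + 1" u v i] unfolding ivl by blast
  next
    case 3
    then show ?thesis using uv by (auto simp: permutes_not_in)
  qed
qed

lemma ex_grassmannian:
  assumes S: "S \<subseteq> {1..n}" "card S = k"
  obtains u where "u \<in> perms_desc n {k}" "u ` {1..k} = S"
proof -
  have fin: "finite S" using S(1) finite_subset by blast
  have k: "k \<le> n" using card_mono[OF _ S(1)] S(2) by simp
  have c: "card ({1..n} - S) = n - k" using S fin by (simp add: card_Diff_subset)
  obtain f where f: "bij_betw f {..<k} S" "strict_mono_on {..<k} f"
    using ex_bij_betw_strict_mono_card[OF fin] S(2) by blast
  obtain g where g: "bij_betw g {..<n - k} ({1..n} - S)" "strict_mono_on {..<n - k} g"
    using ex_bij_betw_strict_mono_card[of "{1..n} - S"] c by auto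
  define u where
    "u i = (if i \<in> {1..k} then f (i - 1) else if i \<in> {k + 1..n} then g (i - k - 1) else i)" for i
  have im1: "u ` {1..k} = S"
  proof -
    have "u ` {1..k} = (\<lambda>i. f (i - 1)) ` {1..k}" by (auto simp: u_def)
    also have "\<dots> = f ` (\<lambda>i. i - 1) ` {1..k}" by (simp add: image_image)
    also have "(\<lambda>i. i - 1) ` {1..k} = {..<k}"
      by (force simp: image_iff Bex_def intro: exI[of _ "Suc _"])
    finally show ?thesis using f(1) by (simp add: bij_betw_def)
  qed
  have im2: "u ` {k + 1..n} = {1..n} - S"
  proof -
    have "u ` {k + 1..n} = (\<lambda>i. g (i - k - 1)) ` {k + 1..n}" by (auto simp: u_def)
    also have "\<dots> = g ` (\<lambda>i. i - k - 1) ` {k + 1..n}" by (simp add: image_image)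
    also have "(\<lambda>i. i - k - 1) ` {k + 1..n} = {..<n - k}"
    proof -
      have "i \<in> (\<lambda>i. i - k - 1) ` {k + 1..n}" if "i < n - k" for i
        using that by (intro image_eqI[of _ _ "i + k + 1"]) auto
      then show ?thesis by auto
    qed
    finally show ?thesis using g(1) by (simp add: bij_betw_def)
  qed
  have "{1..n} = {1..k} \<union> {k + 1..n}" using k by auto
  then have "u ` {1..n} = {1..n}" using im1 im2 S(1) by (simp only: image_Un) auto
  then have "bij_betw u {1..n} {1..n}"
    by (simp add: bij_betw_def eq_card_imp_inj_on)
  then have "u permutes {1..n}"
    by (rule bij_imp_permutes) (use k in \<open>auto simp: u_def\<close>)
  moreover have "strict_mono_on {1..k} u"
    using strict_mono_onD[OF f(2)] by (intro strict_mono_onI) (auto simp: u_def)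
  moreover have "strict_mono_on {k + 1..n} u"
    using strict_mono_onD[OF g(2)] by (intro strict_mono_onI) (auto simp: u_def)
  ultimately show thesis using that im1 by (simp add: perms_desc_singleton[OF k])
qed

lemma is_u_iff:
  assumes "length l = k" "k \<le> n"
  shows "is_u n l u \<longleftrightarrow> u \<in> perms_desc n {k} \<and> (\<forall>i\<in>{1..k}. u i = l ! (k - i) + i)"
  using assms by (auto simp: is_u_def perms_desc_singleton Let_def)

text \<open>
  The definite description in \<^const>\<open>u_perm\<close> is meaningful because \<open>l ! (k - i) + i\<close> is strictly
  increasing in \<open>i\<close>, and therefore lists a \<open>k\<close>-element subset of \<open>{1..n}\<close>.
\<close>
lemma is_u_u_perm:
  assumes l: "partition_in k (n - k) l" and k: "k \<le> n"
  shows "is_u n l (u_perm n l)"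
proof -
  have len: "length l = k" using l by (simp add: partition_in_def)
  let ?f = "\<lambda>i. l ! (k - i) + i"
  have mono: "strict_mono_on {1..k} ?f"
  proof (rule strict_mono_onI)
    fix i j assume ij: "i \<in> {1..k}" "j \<in> {1..k}" "i < j"
    then have "l ! (k - i) \<le> l ! (k - j)"
      using l sorted_wrt_nth_less[of "(\<ge>)" l "k - j" "k - i"] by (auto simp: partition_in_def)
    then show "?f i < ?f j" using ij by simp
  qed
  have "?f i \<le> n" if "i \<in> {1..k}" for i
  proof -
    have "l ! (k - i) \<le> n - k" using l that by (auto simp: partition_in_def)
    then show ?thesis using that k by auto
  qed
  then have "?f ` {1..k} \<subseteq> {1..n}" by auto
  moreover have "card (?f ` {1..k}) = k"
    using strict_mono_on_imp_inj_on[OF mono] by (simp add: card_image)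
  ultimately obtain u where u: "u \<in> perms_desc n {k}" "u ` {1..k} = ?f ` {1..k}"
    by (rule ex_grassmannian)
  have "u i = ?f i" if "i \<in> {1..k}" for i
  proof -
    have ivl: "{1..k} = {1..<k + 1}" by auto
    show ?thesis
      using strict_mono_on_interval_unique[of 1 "k + 1" u ?f i] mono u that
      unfolding perms_desc_singleton[OF k] ivl by blast
  qed
  then have u': "is_u n l u" using u by (simp add: is_u_iff[OF len k])
  have uniq: "v = u" if "is_u n l v" for v
  proof (rule grassmannian_eqI[OF _ u(1) k])
    show "v \<in> perms_desc n {k}" using that by (simp add: is_u_iff[OF len k])
    have "v i = u i" if "i \<in> {1..k}" for i
      using that u' \<open>is_u n l v\<close> by (simp add: is_u_iff[OF len k])
    then show "v ` {1..k} = u ` {1..k}" by (rule image_cong[OF refl])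
  qed
  show ?thesis unfolding u_perm_def using u' uniq by (rule theI)
qed

lemma u_perm_in_perms_desc:
  assumes "partition_in k (n - k) l" "k \<le> n"
  shows "u_perm n l \<in> perms_desc n {k}"
  using is_u_u_perm[OF assms] is_u_iff[of l k n] assms by (simp add: partition_in_def)

lemma u_perm_apply:
  assumes "partition_in k (n - k) l" "k \<le> n" "i \<in> {1..k}"
  shows "u_perm n l i = l ! (k - i) + i"
  using is_u_u_perm[OF assms(1,2)] is_u_iff[of l k n] assms by (simp add: partition_in_def)

lemma u_perm_inject:
  assumes "partition_in k (n - k) l" "partition_in k (n - k) l'" "k \<le> n"
    and eq: "u_perm n l = u_perm n l'"
  shows "l = l'"
proof (rule nth_equalityI)
  show "length l = length l'" using assms by (simp add: partition_in_def)
  fix j assume "j < length l"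
  then show "l ! j = l' ! j"
    using u_perm_apply[OF assms(1,3), of "k - j"] u_perm_apply[OF assms(2,3), of "k - j"] eq
      \<open>j < length l\<close> assms(1)
    by (simp add: partition_in_def Suc_le_eq)
qed

lemma strict_mono_on_gap:
  fixes f :: "nat \<Rightarrow> nat"
  assumes "strict_mono_on {a..b} f" "a \<le> i" "i \<le> j" "j \<le> b"
  shows "f i + (j - i) \<le> f j"
  using assms(3,4)
proof (induction j rule: dec_induct)
  case (step m)
  then have "f m < f (Suc m)"
    using strict_mono_onD[OF assms(1), of m "Suc m"] assms(2) by simp
  then show ?case using step by simp
qed simp

text \<open>
  The part belonging to \<open>i\<close> is the excess \<open>u i - i\<close>. It grows weakly with \<open>i\<close> as \<open>u\<close> is
  strictly increasing, and lies between \<open>0\<close> and \<open>n - k\<close> as \<open>u\<close> maps \<open>{1..k}\<close> into \<open>{1..n}\<close>.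
\<close>
lemma ex_partition_of_grassmannian:
  assumes u: "u \<in> perms_desc n {k}" and k: "k \<le> n"
  obtains l where "partition_in k (n - k) l" "u = u_perm n l"
proof
  define l where "l = map (\<lambda>j. u (k - j) - (k - j)) [0..<k]"
  have len: "length l = k" by (simp add: l_def)
  have perm: "u permutes {1..n}" and mono: "strict_mono_on {1..k} u"
    using u by (auto simp: perms_desc_singleton[OF k])
  have range: "u i \<in> {1..n}" if "i \<in> {1..k}" for i
    using permutes_in_image[OF perm, of i] that k by auto
  have low: "i \<le> u i" if "i \<in> {1..k}" for i
    using strict_mono_on_gap[OF mono, of 1 i] range[of 1] that by auto
  have high: "u i + (k - i) \<le> n" if "i \<in> {1..k}" for i
    using strict_mono_on_gap[OF mono, of i k] range[of k] that by auto
  show l: "partition_in k (n - k) l"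
    unfolding partition_in_def
  proof (intro conjI len)
    have "u (k - j) - (k - j) \<le> u (k - i) - (k - i)" if "i < j" "j < k" for i j
    proof -
      have "u (k - j) + (k - i - (k - j)) \<le> u (k - i)"
        by (rule strict_mono_on_gap[OF mono]) (use that in auto)
      then show ?thesis using that by linarith
    qed
    then show "sorted_wrt (\<ge>) l" by (simp add: sorted_wrt_iff_nth_less l_def)
    have "u (k - j) - (k - j) \<le> n - k" if "j < k" for j
      using high[of "k - j"] that k by simp linarith
    then show "\<forall>x\<in>set l. x \<le> n - k" by (auto simp: l_def)
  qed
  show "u = u_perm n l"
  proof (rule grassmannian_eqI[OF u u_perm_in_perms_desc[OF l k] k])
    have "u i = u_perm n l i" if "i \<in> {1..k}" for i
      using u_perm_apply[OF l k that] low[OF that] that by (simp add: l_def)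
    then show "u ` {1..k} = u_perm n l ` {1..k}" by (rule image_cong[OF refl])
  qed
qed

lemma bij_betw_u_perm:
  assumes "k \<le> n"
  shows "bij_betw (u_perm n) {l. partition_in k (n - k) l} (perms_desc n {k})"
  unfolding bij_betw_def
proof (intro conjI inj_onI equalityI subsetI)
  fix u assume "u \<in> perms_desc n {k}"
  then show "u \<in> u_perm n ` {l. partition_in k (n - k) l}"
    by (rule ex_partition_of_grassmannian[OF _ assms]) blast
qed (use assms u_perm_inject u_perm_in_perms_desc in auto)

section \<open>Factoring a permutation at the position of 1\<close>

text \<open>
  The inverse of \<^const>\<open>relabel\<close>: a permutation of \<open>{1..m}\<close> moved to \<open>{d + 1..d + m}\<close>.
\<close>
definition lift_perm :: "nat \<Rightarrow> (nat \<Rightarrow> nat) \<Rightarrow> nat \<Rightarrow> nat" where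
  "lift_perm d b i = (if i \<le> d then i else b (i - d) + d)"

lemma lift_perm_permutes:
  assumes "b permutes {1..m}"
  shows "lift_perm d b permutes {d + 1..d + m}"
proof (rule inj_imp_permutes)
  show "inj_on (lift_perm d b) {d + 1..d + m}"
  proof (rule inj_onI)
    fix x y assume xy: "x \<in> {d + 1..d + m}" "y \<in> {d + 1..d + m}" "lift_perm d b x = lift_perm d b y"
    then have "b (x - d) = b (y - d)" by (simp add: lift_perm_def)
    then have "x - d = y - d" using permutes_inj[OF assms] by (simp add: inj_eq)
    then show "x = y" using xy by auto
  qed
  show "lift_perm d b x \<in> {d + 1..d + m}" if "x \<in> {d + 1..d + m}" for x
  proof -
    have "x - d \<in> {1..m}" using that by auto
    then have "b (x - d) \<in> {1..m}" using permutes_in_image[OF assms] by blast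
    then show ?thesis using that by (auto simp: lift_perm_def)
  qed
  show "lift_perm d b x = x" if "x \<notin> {d + 1..d + m}" for x
  proof (cases "x \<le> d")
    case False
    then have "x - d \<notin> {1..m}" using that by auto
    then show ?thesis using permutes_not_in[OF assms] False by (simp add: lift_perm_def)
  qed (simp add: lift_perm_def)
qed simp

lemma relabel_permutes:
  assumes "b permutes {d + 1..d + m}"
  shows "relabel d b permutes {1..m}"
proof (rule inj_imp_permutes)
  have gt: "b (x + d) > d" if "x \<ge> 1" "x \<le> m" for x
    using permutes_in_image[OF assms, of "x + d"] that by auto
  show "inj_on (relabel d b) {1..m}"
  proof (rule inj_onI)
    fix x y assume "x \<in> {1..m}" "y \<in> {1..m}" "relabel d b x = relabel d b y"
    then have "b (x + d) = b (y + d)"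
      using gt[of x] gt[of y] by (auto simp: relabel_def)
    then show "x = y" using permutes_inj[OF assms] by (simp add: inj_eq)
  qed
  show "relabel d b x \<in> {1..m}" if "x \<in> {1..m}" for x
    using permutes_in_image[OF assms, of "x + d"] that by (auto simp: relabel_def)
  show "relabel d b x = x" if "x \<notin> {1..m}" for x
    using permutes_not_in[OF assms, of "x + d"] that by (auto simp: relabel_def)
qed simp

lemma relabel_lift_perm: "b permutes {1..m} \<Longrightarrow> relabel d (lift_perm d b) = b"
  using permutes_not_in[of b "{1..m}" 0] by (auto simp: relabel_def lift_perm_def fun_eq_iff)

lemma lift_perm_relabel:
  assumes "b permutes {d + 1..d + m}"
  shows "lift_perm d (relabel d b) = b"
proof
  fix i
  have "d < b i" if "d < i"
    using permutes_in_image[OF assms, of i] permutes_not_in[OF assms, of i] that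
    by (cases "i \<in> {d + 1..d + m}") auto
  then show "lift_perm d (relabel d b) i = b i"
    using permutes_not_in[OF assms, of i] by (auto simp: lift_perm_def relabel_def)
qed

text \<open>
  The image of \<open>{1..k}\<close> under the product is its image under the first factor alone, which
  determines that factor. The other two have disjoint supports, so they can be read off from
  their product.
\<close>
lemma factor_unique:
  assumes l: "partition_in k (n - k) l" "partition_in k (n - k) l'" and k: "k \<le> n"
    and a: "a permutes {1..k}" "a' permutes {1..k}"
    and b: "b permutes {k + 2..n}" "b' permutes {k + 2..n}"
    and eq: "u_perm n l \<circ> a \<circ> b = u_perm n l' \<circ> a' \<circ> b'"
  shows "l = l' \<and> a = a' \<and> b = b'"
proof -
  have im: "(u \<circ> p \<circ> r) ` {1..k} = u ` {1..k}"
    if "p permutes {1..k}" "r permutes {k + 2..n}" for u p r :: "nat \<Rightarrow> nat"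
  proof -
    have "r ` {1..k} = {1..k}"
      using permutes_not_in[OF that(2)] by (force simp: image_iff)
    then show ?thesis using permutes_image[OF that(1)] by (metis image_comp)
  qed
  have "u_perm n l ` {1..k} = u_perm n l' ` {1..k}"
    using im[OF a(1) b(1), of "u_perm n l"] im[OF a(2) b(2), of "u_perm n l'"] eq by simp
  then have "u_perm n l = u_perm n l'"
    using u_perm_in_perms_desc[OF l(1) k] u_perm_in_perms_desc[OF l(2) k] k
    by (blast intro: grassmannian_eqI)
  moreover from this have "l = l'"
    using u_perm_inject l k by blast
  moreover have "inj (u_perm n l)"
    using u_perm_in_perms_desc[OF l(1) k] by (auto simp: perms_desc_def permutes_inj)
  ultimately have ab: "a (b i) = a' (b' i)" for i
    using fun_cong[OF eq, of i] by (simp add: inj_eq)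
  have low: "p (r i) = p i \<and> r i = i" and high: "p (r j) = r j \<and> p j = j"
    if "p permutes {1..k}" "r permutes {k + 2..n}" "i \<le> k" "k < j" for p r :: "nat \<Rightarrow> nat" and i j
  proof -
    show "p (r i) = p i \<and> r i = i" using permutes_not_in[OF that(2), of i] that(3) by auto
    have "k < r j"
      using permutes_not_in[OF that(2), of j] permutes_in_image[OF that(2), of j] that(4)
      by (cases "j \<in> {k + 2..n}") auto
    then show "p (r j) = r j \<and> p j = j"
      using permutes_not_in[OF that(1)] that(4) by auto
  qed
  have "a i = a' i \<and> b i = b' i" for i
    using ab[of i] low[OF a(1) b(1), of i "Suc k"] low[OF a(2) b(2), of i "Suc k"]
      high[OF a(1) b(1), of 0 i] high[OF a(2) b(2), of 0 i]
    by (cases "i \<le> k") auto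
  then show ?thesis using \<open>l = l'\<close> by auto
qed

text \<open>
  By \<open>factor_unique\<close>, the definite description in \<^const>\<open>wt_factor\<close> returns any factorisation of
  the right shape.
\<close>
lemma wt_factor_eqI:
  assumes "partition_in k (n - k) l" "k \<le> n" "a permutes {1..k}" "b permutes {k + 2..n}"
    and "w = u_perm n l \<circ> a \<circ> b" "inv w 1 = k + 1"
  shows "wt_factor n w = (l, a, b)"
  unfolding wt_factor_def Let_def
proof (rule the_equality)
  have k: "inv w 1 - 1 = k" using assms(6) by simp
  show "case (l, a, b) of (l, a, b) \<Rightarrow> partition_in (inv w 1 - 1) (n - (inv w 1 - 1)) l \<and>
      a permutes {1..inv w 1 - 1} \<and> b permutes {inv w 1 - 1 + 2..n} \<and> w = u_perm n l \<circ> a \<circ> b"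
    unfolding k prod.case using assms(1-5) by blast
  fix x
  assume x: "case x of (l, a, b) \<Rightarrow> partition_in (inv w 1 - 1) (n - (inv w 1 - 1)) l \<and>
      a permutes {1..inv w 1 - 1} \<and> b permutes {inv w 1 - 1 + 2..n} \<and> w = u_perm n l \<circ> a \<circ> b"
  obtain l' a' b' where x': "x = (l', a', b')" by (cases x)
  have "partition_in k (n - k) l'" "a' permutes {1..k}" "b' permutes {k + 2..n}"
    "w = u_perm n l' \<circ> a' \<circ> b'"
    using x unfolding x' prod.case k by blast+
  then have "l' = l \<and> a' = a \<and> b' = b"
    using assms(1-5) by (intro factor_unique[of k n]) auto
  then show "x = (l, a, b)" using x' by simp
qed

text \<open>
  The value \<open>1\<close> is the first entry of whichever increasing run contains it.
\<close>
lemma u_at_1: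
  assumes u: "u \<in> perms_desc n {k}" and k: "k < n"
  shows "u (k + 1) = 1 \<longleftrightarrow> 1 \<notin> u ` {1..k}"
proof -
  have perm: "u permutes {1..n}" and mono: "strict_mono_on {k + 1..n} u"
    using u k by (auto simp: perms_desc_singleton)
  show ?thesis
  proof
    assume "u (k + 1) = 1"
    then show "1 \<notin> u ` {1..k}"
      using permutes_inj[OF perm] by (metis (no_types, lifting) Suc_eq_plus1 atLeastAtMost_iff
          image_iff injD not_less_eq_eq order_refl)
  next
    assume n1: "1 \<notin> u ` {1..k}"
    have "1 \<in> u ` {1..n}" using permutes_image[OF perm] k by simp
    then obtain j where j: "j \<in> {1..n}" "u j = 1" by auto
    then have "k + 1 \<le> j" using n1 by (force simp: not_less_eq_eq)
    moreover have "u (k + 1) \<ge> 1"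
      using permutes_in_image[OF perm, of "k + 1"] k by simp
    ultimately show "u (k + 1) = 1"
      using strict_mono_onD[OF mono, of "k + 1" j] j k by (cases "j = k + 1") auto
  qed
qed

lemma factor_apply:
  fixes u a c :: "nat \<Rightarrow> nat"
  assumes "a permutes {1..k}"
  shows "i \<le> k \<Longrightarrow> (u \<circ> a \<circ> lift_perm (k + 1) c) i = u (a i)"
    and "(u \<circ> a \<circ> lift_perm (k + 1) c) (k + 1) = u (k + 1)"
    and "1 \<le> j \<Longrightarrow> (u \<circ> a \<circ> lift_perm (k + 1) c) (j + (k + 1)) = u (c j + (k + 1))"
  using permutes_not_in[OF assms, of "k + 1"] permutes_not_in[OF assms, of "c j + (k + 1)"]
  by (simp_all add: lift_perm_def)

text \<open>
  Left of the position \<open>k + 1\<close>, the word of the product is that of \<open>a\<close> with its values replaced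
  monotonically, so it has the descents of \<open>a\<close>; right of it, likewise, those of \<open>c\<close>. The entry \<open>1\<close>
  at the position \<open>k + 1\<close> itself forces a descent just before it and forbids one just after it.
\<close>
lemma descents_factor:
  assumes u: "u \<in> perms_desc n {k}" "u (k + 1) = 1" and k: "k < n"
    and a: "a permutes {1..k}" and c: "c permutes {1..n - k - 1}"
  shows "u \<circ> a \<circ> lift_perm (k + 1) c \<in> perms_desc n D \<longleftrightarrow>
    (k = 0 \<or> k \<in> D) \<and> a \<in> perms_desc k D \<and> c \<in> perms_desc (n - k - 1) {i. i + (k + 1) \<in> D}"
    (is "?w \<in> _ \<longleftrightarrow> _")
proof -
  have perm: "u permutes {1..n}" and mono: "strict_mono_on {1..k} u" "strict_mono_on {k + 1..n} u"
    using u(1) k by (auto simp: perms_desc_singleton)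
  note w = factor_apply[OF a, where u = u and c = c]
  have "lift_perm (k + 1) c permutes {k + 1 + 1..k + 1 + (n - k - 1)}"
    by (rule lift_perm_permutes[OF c])
  then have "lift_perm (k + 1) c permutes {1..n}"
    by (rule permutes_subset) (use k in auto)
  moreover have "a permutes {1..n}"
    using a by (rule permutes_subset) (use k in auto)
  ultimately have wperm: "?w permutes {1..n}"
    using perm by (intro permutes_compose)
  have lt: "?w (i + 1) < ?w i \<longleftrightarrow> a (i + 1) < a i" if "1 \<le> i" "i < k" for i
  proof -
    have "a i \<in> {1..k}" "a (i + 1) \<in> {1..k}"
      using that permutes_in_image[OF a, of i] permutes_in_image[OF a, of "i + 1"] by auto
    then show ?thesis
      using w(1)[of i] w(1)[of "i + 1"] that strict_mono_on_less[OF mono(1)] by simp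
  qed
  have eq: "?w (k + 1) < ?w k" if "1 \<le> k"
  proof -
    have "?w k \<in> {1..n}" using permutes_in_image[OF wperm, of k] that k by simp
    moreover have "?w k \<noteq> ?w (k + 1)" using permutes_inj[OF wperm] by (metis injD n_not_Suc_n Suc_eq_plus1)
    ultimately show ?thesis using w(2) u(2) by auto
  qed
  have eq1: "\<not> ?w (k + 1 + 1) < ?w (k + 1)" if "k + 1 < n"
    using permutes_in_image[OF wperm, of "k + 1 + 1"] that w(2) u(2) by auto
  have gt: "?w (j + (k + 1) + 1) < ?w (j + (k + 1)) \<longleftrightarrow> c (j + 1) < c j"
    if "1 \<le> j" "j < n - k - 1" for j
  proof -
    have "c j \<in> {1..n - k - 1}" "c (j + 1) \<in> {1..n - k - 1}"
      using that permutes_in_image[OF c, of j] permutes_in_image[OF c, of "j + 1"] by auto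
    then have "c j + (k + 1) \<in> {k + 1..n}" "c (j + 1) + (k + 1) \<in> {k + 1..n}"
      using k by auto
    then show ?thesis
      using w(3)[of j] w(3)[of "j + 1"] that strict_mono_on_less[OF mono(2), of "c (j+1) + (k+1)" "c j + (k+1)"]
      by (simp add: ac_simps)
  qed
  have "(\<forall>i\<in>{1..<n}. ?w i > ?w (i + 1) \<longrightarrow> i \<in> D) \<longleftrightarrow> (k = 0 \<or> k \<in> D) \<and>
    (\<forall>i\<in>{1..<k}. a i > a (i + 1) \<longrightarrow> i \<in> D) \<and>
    (\<forall>i\<in>{1..<n - k - 1}. c i > c (i + 1) \<longrightarrow> i + (k + 1) \<in> D)" (is "?L \<longleftrightarrow> ?R")
  proof
    assume L: ?L
    have "k = 0 \<or> k \<in> D" using L eq k by (cases "k = 0") auto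
    moreover have "i \<in> D" if "i \<in> {1..<k}" "a i > a (i + 1)" for i
      using L lt[of i] that k by auto
    moreover have "i + (k + 1) \<in> D" if "i \<in> {1..<n - k - 1}" "c i > c (i + 1)" for i
      using bspec[OF L, of "i + (k + 1)"] gt[of i] that k by auto
    ultimately show ?R by blast
  next
    assume R: ?R
    show ?L
    proof (intro ballI impI)
      fix i assume i: "i \<in> {1..<n}" and d: "?w (i + 1) < ?w i"
      consider "i < k" | "i = k" | "i = k + 1" | "1 \<le> i - (k + 1)" "i = (i - (k + 1)) + (k + 1)"
        by linarith
      then show "i \<in> D"
      proof cases
        case 1
        then show ?thesis using R lt[of i] i d by auto
      next
        case 2
        then show ?thesis using R i by auto
      next
        case 3
        then show ?thesis using eq1 i d by auto
      next
        case 4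
        moreover define j where "j = i - (k + 1)"
        ultimately have j: "1 \<le> j" "i = j + (k + 1)" by auto
        then have "j < n - k - 1" using i by auto
        then show ?thesis using R gt[of j] j d by auto
      qed
    qed
  qed
  then show ?thesis
    using wperm a c by (simp add: perms_desc_def)
qed

lemma partition_in_map_Suc:
  assumes "partition_in k (n - 1 - k) l" "k < n"
  shows "partition_in k (n - k) (map Suc l)"
  using assms by (force simp: partition_in_def sorted_wrt_map)

lemma u_perm_map_Suc_at_1:
  assumes l: "partition_in k (n - 1 - k) l" and k: "k < n"
  shows "u_perm n (map Suc l) (k + 1) = 1"
proof -
  note l' = partition_in_map_Suc[OF assms]
  have len: "length l = k" using l by (simp add: partition_in_def)
  have "u_perm n (map Suc l) i \<noteq> 1" if "i \<in> {1..k}" for i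
    using u_perm_apply[OF l' _ that] k len that by simp
  then have "1 \<notin> u_perm n (map Suc l) ` {1..k}" by (metis imageE)
  then show ?thesis
    using u_at_1[OF u_perm_in_perms_desc[OF l']] k by simp
qed

text \<open>
  Let \<open>u\<close> be the Grassmannian permutation with the same image of \<open>{1..k}\<close> as \<open>w\<close>. Then
  \<open>inv u \<circ> w\<close> preserves \<open>{1..k}\<close> and fixes \<open>k + 1\<close>, so it splits into \<open>a\<close> and \<open>c\<close>. No part of the
  partition of \<open>u\<close> is \<open>0\<close>, because the value \<open>1\<close> occurs after the position \<open>k\<close>.
\<close>
lemma factor_exists:
  assumes w: "w permutes {1..n}" "w (k + 1) = 1" and k: "k < n"
  obtains l a c where "partition_in k (n - 1 - k) l" "a permutes {1..k}" "c permutes {1..n - k - 1}"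
    "w = u_perm n (map Suc l) \<circ> a \<circ> lift_perm (k + 1) c"
proof -
  have injw: "inj w" by (rule permutes_inj[OF w(1)])
  have "w ` {1..k} \<subseteq> w ` {1..n}" using k by (intro image_mono) auto
  then have "w ` {1..k} \<subseteq> {1..n}" using permutes_image[OF w(1)] by simp
  moreover have "card (w ` {1..k}) = k"
    using injw by (simp add: card_image inj_on_subset)
  ultimately obtain u where u: "u \<in> perms_desc n {k}" "u ` {1..k} = w ` {1..k}"
    by (rule ex_grassmannian)
  have perm: "u permutes {1..n}" and mono: "strict_mono_on {1..k} u"
    using u(1) k by (auto simp: perms_desc_singleton)
  have not1: "1 \<notin> u ` {1..k}"
    unfolding u(2) using injw w(2) by (metis (no_types, lifting) Suc_eq_plus1 atLeastAtMost_iff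
          image_iff injD not_less_eq_eq order_refl)
  then have u1: "u (k + 1) = 1" using u_at_1[OF u(1) k] by simp
  have u2: "u i \<ge> i + 1" if "i \<in> {1..k}" for i
  proof -
    have "u 1 \<in> u ` {1..k}" using that by auto
    then have "u 1 \<noteq> 1" using not1 by metis
    moreover have "u 1 \<ge> 1" using permutes_in_image[OF perm, of 1] k by simp
    ultimately have "u 1 \<ge> 2" by simp
    then show ?thesis using strict_mono_on_gap[OF mono, of 1 i] that by auto
  qed
  obtain l where l: "partition_in k (n - k) l" "u = u_perm n l"
    using ex_partition_of_grassmannian[OF u(1)] k by auto
  have pos: "x \<ge> 1" if "x \<in> set l" for x
  proof -
    obtain j where j: "j < k" "x = l ! j"
      using \<open>x \<in> set l\<close> l(1) by (auto simp: in_set_conv_nth partition_in_def)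
    then show ?thesis
      using u_perm_apply[OF l(1), of "k - j"] u2[of "k - j"] k l(2) by (simp add: Suc_le_eq)
  qed
  define l0 where "l0 = map (\<lambda>x. x - 1) l"
  have "map Suc l0 = map id l"
    unfolding l0_def map_map
  proof (rule map_cong[OF refl])
    fix x assume "x \<in> set l"
    then show "(Suc \<circ> (\<lambda>x. x - 1)) x = id x" using pos[of x] by simp
  qed
  then have "map Suc l0 = l" by simp
  moreover have l0: "partition_in k (n - 1 - k) l0"
    unfolding partition_in_def
  proof (intro conjI ballI)
    show "length l0 = k" using l(1) by (simp add: partition_in_def l0_def)
    show "sorted_wrt (\<ge>) l0"
      using l(1) by (simp add: partition_in_def l0_def sorted_wrt_iff_nth_less diff_le_mono)
    fix x assume "x \<in> set l0"
    then obtain y where "y \<in> set l" "x = y - 1" by (auto simp: l0_def)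
    moreover have "y \<le> n - k" using l(1) \<open>y \<in> set l\<close> by (simp add: partition_in_def)
    ultimately show "x \<le> n - 1 - k" by simp
  qed
  ultimately have u': "u = u_perm n (map Suc l0)" using l(2) by simp
  define v where "v = inv u \<circ> w"
  have v: "v permutes {1..n}"
    unfolding v_def by (rule permutes_compose[OF w(1) permutes_inv[OF perm]])
  have uv: "u (v i) = w i" for i
    using permutes_inverses(1)[OF perm] by (simp add: v_def)
  have vk: "v ` {1..k} = {1..k}"
  proof -
    have "v ` {1..k} = inv u ` u ` {1..k}" unfolding v_def u(2) by (simp add: image_comp)
    then show ?thesis using permutes_inverses(2)[OF perm] by (simp add: image_image)
  qed
  have vk1: "v (k + 1) = k + 1"
    unfolding v_def using w(2) u1 permutes_inverses(2)[OF perm, of "k + 1"] by simp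
  have injv: "inj v" by (rule permutes_inj[OF v])
  define a where "a i = (if i \<le> k then v i else i)" for i
  define b where "b i = (if i \<le> k + 1 then i else v i)" for i
  have v0: "v 0 = 0" using permutes_not_in[OF v] by simp
  have a: "a permutes {1..k}"
  proof (rule inj_imp_permutes)
    show "inj_on a {1..k}"
    proof (rule inj_onI)
      fix x y assume "x \<in> {1..k}" "y \<in> {1..k}" "a x = a y"
      then have "v x = v y" by (simp add: a_def)
      then show "x = y" by (rule injD[OF injv])
    qed
    show "a x \<in> {1..k}" if "x \<in> {1..k}" for x
    proof -
      have "v x \<in> {1..k}" using imageI[OF that, of v] by (simp only: vk)
      then show ?thesis using that by (simp add: a_def)
    qed
    show "a x = x" if "x \<notin> {1..k}" for x
      using that v0 by (cases "x = 0") (auto simp: a_def)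
  qed simp
  have vgt: "v x > k + 1" if "x > k + 1" for x
  proof (rule ccontr)
    assume "\<not> v x > k + 1"
    then consider "v x = 0" | "v x \<in> {1..k}" | "v x = k + 1" by fastforce
    then have "\<exists>y\<le>k + 1. v x = v y"
    proof cases
      case 2
      then have "v x \<in> v ` {1..k}" by (simp only: vk)
      then obtain y where "y \<in> {1..k}" "v x = v y" by blast
      then show ?thesis by (intro exI[of _ y]) simp
    next
      case 1
      then show ?thesis using v0 by (intro exI[of _ 0]) simp
    next
      case 3
      then show ?thesis using vk1 by (intro exI[of _ "k + 1"]) simp
    qed
    then show False using that injv by (auto simp: inj_eq)
  qed
  have b: "b permutes {k + 2..n}"
  proof (rule inj_imp_permutes)
    show "inj_on b {k + 2..n}"
    proof (rule inj_onI)
      fix x y assume "x \<in> {k + 2..n}" "y \<in> {k + 2..n}" "b x = b y"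
      then have "v x = v y" by (simp add: b_def)
      then show "x = y" by (rule injD[OF injv])
    qed
    show "b x \<in> {k + 2..n}" if "x \<in> {k + 2..n}" for x
      using vgt[of x] permutes_in_image[OF v, of x] that by (auto simp: b_def)
    show "b x = x" if "x \<notin> {k + 2..n}" for x
      using that permutes_not_in[OF v, of x] by (auto simp: b_def)
  qed simp
  then have b': "b permutes {(k + 1) + 1..(k + 1) + (n - k - 1)}" using k by simp
  have w': "w = u \<circ> a \<circ> b"
  proof
    fix i
    show "w i = (u \<circ> a \<circ> b) i"
      using uv[of i] vgt[of i] vk1 by (cases "i = k + 1") (auto simp: a_def b_def)
  qed
  show thesis
    by (rule that[OF l0 a relabel_permutes[OF b']])
       (simp only: lift_perm_relabel[OF b'] w' u')
qed

lemma bij_betw_factor: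
  assumes k: "k < n" "k = 0 \<or> k \<in> D"
  shows "bij_betw (\<lambda>(l, a, c). u_perm n (map Suc l) \<circ> a \<circ> lift_perm (k + 1) c)
    ({l. partition_in k (n - 1 - k) l} \<times> perms_desc k D \<times>
      perms_desc (n - k - 1) {i. i + (k + 1) \<in> D})
    {w \<in> perms_desc n D. w (k + 1) = 1}" (is "bij_betw ?f ?X ?Y")
proof -
  have lift: "lift_perm (k + 1) c permutes {k + 2..n}" if "c permutes {1..n - k - 1}" for c
    using lift_perm_permutes[OF that, of "k + 1"] k(1) by simp
  have "inj_on ?f ?X"
  proof (clarsimp simp: inj_on_def perms_desc_def simp del: o_apply, intro conjI)
    fix l a c l' a' c'
    assume l: "partition_in k (n - Suc k) l" "partition_in k (n - Suc k) l'"
      and a: "a permutes {Suc 0..k}" "a' permutes {Suc 0..k}"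
      and c: "c permutes {Suc 0..n - Suc k}" "c' permutes {Suc 0..n - Suc k}"
      and eq: "u_perm n (map Suc l) \<circ> a \<circ> lift_perm (Suc k) c =
        u_perm n (map Suc l') \<circ> a' \<circ> lift_perm (Suc k) c'"
    have "map Suc l = map Suc l' \<and> a = a' \<and> lift_perm (k + 1) c = lift_perm (k + 1) c'"
      by (rule factor_unique[where n = n and k = k])
         (use l a c eq k lift partition_in_map_Suc[of k n] in auto)
    then show "l = l'" "a = a'" "c = c'"
      using relabel_lift_perm[of c "n - k - 1" "k + 1"] relabel_lift_perm[of c' "n - k - 1" "k + 1"] c
      by (auto simp: inj_map_eq_map)
  qed
  moreover have "?f ` ?X \<subseteq> ?Y"
  proof (rule image_subsetI)
    fix x assume "x \<in> ?X"
    then obtain l a c where x: "x = (l, a, c)" and l: "partition_in k (n - 1 - k) l"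
      and a: "a \<in> perms_desc k D" and c: "c \<in> perms_desc (n - k - 1) {i. i + (k + 1) \<in> D}"
      by blast
    have ac: "a permutes {1..k}" "c permutes {1..n - k - 1}"
      using a c by (auto simp: perms_desc_def)
    note u1 = u_perm_map_Suc_at_1[OF l k(1)]
    have u: "u_perm n (map Suc l) \<in> perms_desc n {k}"
      using u_perm_in_perms_desc[OF partition_in_map_Suc[OF l k(1)]] k(1) by simp
    show "?f x \<in> ?Y"
      using descents_factor[OF u u1 k(1) ac, of D] factor_apply(2)[OF ac(1)] u1 k(2) a c
      unfolding x by (simp del: o_apply)
  qed
  moreover have "?Y \<subseteq> ?f ` ?X"
  proof clarify
    fix w assume w: "w \<in> perms_desc n D" "w (k + 1) = 1"
    then have wp: "w permutes {1..n}" by (simp add: perms_desc_def)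
    obtain l a c where f: "partition_in k (n - 1 - k) l" "a permutes {1..k}"
      "c permutes {1..n - k - 1}" "w = u_perm n (map Suc l) \<circ> a \<circ> lift_perm (k + 1) c"
      by (rule factor_exists[OF wp w(2) k(1)])
    have u: "u_perm n (map Suc l) \<in> perms_desc n {k}"
      using u_perm_in_perms_desc[OF partition_in_map_Suc[OF f(1) k(1)]] k(1) by simp
    have "a \<in> perms_desc k D \<and> c \<in> perms_desc (n - k - 1) {i. i + (k + 1) \<in> D}"
      using descents_factor[OF u u_perm_map_Suc_at_1[OF f(1) k(1)] k(1) f(2,3), of D] w(1) f(4)
      by blast
    then show "w \<in> ?f ` ?X" using f by (intro image_eqI[of _ _ "(l, a, c)"]) auto
  qed
  ultimately show ?thesis by (auto simp: bij_betw_def)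
qed

section \<open>The recursion for sums of weights\<close>

abbreviation wt_coeff :: "nat \<Rightarrow> qfield" where
  "wt_coeff k \<equiv> tpow (qpow k - qpow 0) * (phi (qtfact k) / qtfact k)"

text \<open>
  The recursive equation of \<^const>\<open>wt\<close> in terms of the parameters \<open>(l, a, c)\<close> of
  \<open>bij_betw_factor\<close>: \<open>l\<close> is the reduced partition, with one taken off every part.
\<close>
lemma wt_factored:
  assumes n: "2 \<le> n" and k: "k < n" and l: "partition_in k (n - 1 - k) l"
    and a: "a permutes {1..k}" and c: "c permutes {1..n - k - 1}"
  shows "wt n (u_perm n (map Suc l) \<circ> a \<circ> lift_perm (k + 1) c) =
    wt_coeff k * phi (wt (n - 1) (u_perm (n - 1) l)) * wt k a * (phi ^^ (k + 1)) (wt (n - k - 1) c)"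
proof -
  let ?w = "u_perm n (map Suc l) \<circ> a \<circ> lift_perm (k + 1) c"
  have b: "lift_perm (k + 1) c permutes {k + 2..n}"
    using lift_perm_permutes[OF c, of "k + 1"] k by simp
  have perm: "?w permutes {1..n}"
  proof (intro permutes_compose)
    show "u_perm n (map Suc l) permutes {1..n}"
      using u_perm_in_perms_desc[OF partition_in_map_Suc[OF l k]] k by (simp add: perms_desc_def)
    show "a permutes {1..n}" using a by (rule permutes_subset) (use k in auto)
    show "lift_perm (k + 1) c permutes {1..n}" using b by (rule permutes_subset) (use k in auto)
  qed
  have "?w (k + 1) = 1" by (simp only: factor_apply(2)[OF a] u_perm_map_Suc_at_1[OF l k])
  then have inv: "inv ?w 1 = k + 1" by (simp only: permutes_inv_eq[OF perm])
  have f: "wt_factor n ?w = (map Suc l, a, lift_perm (k + 1) c)"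
    by (rule wt_factor_eqI[OF partition_in_map_Suc[OF l k] _ a b refl inv]) (use k in simp)
  have m: "map (\<lambda>x. x - 1) (map Suc l) = l" by (simp add: o_def)
  show ?thesis
    using n perm
    by (subst wt.simps) (simp only: f inv m relabel_lift_perm[OF c] Let_def split
        if_True if_False add_diff_cancel_right' not_le numeral_2_eq_2, simp)
qed

lemma sum_triple_product:
  fixes f :: "'a \<Rightarrow> 'r::comm_semiring_0"
  shows "(\<Sum>(x, y, z)\<in>A \<times> B \<times> C. r * f x * (g y * h z)) = r * sum f A * (sum g B * sum h C)"
proof -
  have "sum g B * sum h C = (\<Sum>p\<in>B \<times> C. g (fst p) * h (snd p))"
    by (simp add: sum_product sum.cartesian_product split_beta)
  moreover have "r * sum f A = (\<Sum>x\<in>A. r * f x)" by (rule sum_distrib_left)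
  ultimately show ?thesis
    by (simp add: sum_product sum.cartesian_product split_beta)
qed

lemma sum_perms_desc_at:
  assumes n: "2 \<le> n" and k: "k < n" "k = 0 \<or> k \<in> D"
  shows "(\<Sum>w | w \<in> perms_desc n D \<and> w (k + 1) = 1. wt n w) =
    wt_coeff k * phi (\<Sum>u\<in>perms_desc (n - 1) {k}. wt (n - 1) u) * (\<Sum>a\<in>perms_desc k D. wt k a) *
      (phi ^^ (k + 1)) (\<Sum>c\<in>perms_desc (n - k - 1) {i. i + (k + 1) \<in> D}. wt (n - k - 1) c)"
proof -
  let ?L = "{l. partition_in k (n - 1 - k) l}" and ?C = "perms_desc (n - k - 1) {i. i + (k + 1) \<in> D}"
  have "(\<Sum>w | w \<in> perms_desc n D \<and> w (k + 1) = 1. wt n w) =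
      (\<Sum>(l, a, c) \<in> ?L \<times> perms_desc k D \<times> ?C.
        wt n (u_perm n (map Suc l) \<circ> a \<circ> lift_perm (k + 1) c))"
    by (subst sum.reindex_bij_betw[OF bij_betw_factor[OF k], symmetric]) (simp add: split_beta)
  also have "\<dots> = (\<Sum>(l, a, c) \<in> ?L \<times> perms_desc k D \<times> ?C.
      wt_coeff k * phi (wt (n - 1) (u_perm (n - 1) l)) * (wt k a * (phi ^^ (k + 1)) (wt (n - k - 1) c)))"
  proof (intro sum.cong refl)
    fix x assume "x \<in> ?L \<times> perms_desc k D \<times> ?C"
    then obtain l a c where x: "x = (l, a, c)" and "partition_in k (n - 1 - k) l"
      "a permutes {1..k}" "c permutes {1..n - k - 1}"
      by (auto simp: perms_desc_def)
    then show "(case x of (l, a, c) \<Rightarrow> wt n (u_perm n (map Suc l) \<circ> a \<circ> lift_perm (k + 1) c)) =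
      (case x of (l, a, c) \<Rightarrow> wt_coeff k * phi (wt (n - 1) (u_perm (n - 1) l)) *
        (wt k a * (phi ^^ (k + 1)) (wt (n - k - 1) c)))"
      unfolding x prod.case using wt_factored[OF n k(1)] by (simp only: mult.assoc)
  qed
  also have "\<dots> = wt_coeff k * (\<Sum>l\<in>?L. phi (wt (n - 1) (u_perm (n - 1) l))) *
      ((\<Sum>a\<in>perms_desc k D. wt k a) * (\<Sum>c\<in>?C. (phi ^^ (k + 1)) (wt (n - k - 1) c)))"
    by (rule sum_triple_product)
  also have "(\<Sum>l\<in>?L. phi (wt (n - 1) (u_perm (n - 1) l))) =
      (\<Sum>u\<in>perms_desc (n - 1) {k}. phi (wt (n - 1) u))"
    by (rule sum.reindex_bij_betw[OF bij_betw_u_perm]) (use k in simp)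
  finally show ?thesis
    by (simp only: phi_sum phi_pow_sum mult.assoc)
qed

text \<open>
  The permutations are sorted by the position \<open>k + 1\<close> of the value \<open>1\<close>, and \<open>bij_betw_factor\<close>
  makes each class a product of three sets.
  For \<open>n = 1\<close> the weight is \<open>1\<close> by convention and not by the recursion, but the sum on the right
  has the single term \<open>k = 0\<close>, which is also \<open>1\<close>.
\<close>
lemma sum_perms_desc_rec:
  assumes n: "1 \<le> n"
  shows "(\<Sum>w\<in>perms_desc n D. wt n w) = (\<Sum>k | k < n \<and> (k = 0 \<or> k \<in> D).
    wt_coeff k * phi (\<Sum>u\<in>perms_desc (n - 1) {k}. wt (n - 1) u) * (\<Sum>a\<in>perms_desc k D. wt k a) *
      (phi ^^ (k + 1)) (\<Sum>c\<in>perms_desc (n - k - 1) {i. i + (k + 1) \<in> D}. wt (n - k - 1) c))"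
proof (cases "n = 1")
  case True
  have "perms_desc m E = {id}" if "m \<le> 1" for m E
    using that by (cases "m = 0") (auto simp: perms_desc_def le_Suc_eq)
  moreover have "{k. k < Suc 0 \<and> (k = 0 \<or> k \<in> D)} = {0}" by auto
  ultimately show ?thesis
    using True by (simp add: wt.simps qtfact_0 tpow_def)
next
  case False
  let ?K = "{k. k < n \<and> (k = 0 \<or> k \<in> D)}"
  have cov: "inv w 1 - 1 \<in> ?K \<and> w (inv w 1 - 1 + 1) = 1" if w: "w \<in> perms_desc n D" for w
  proof -
    have perm: "w permutes {1..n}" using w by (simp add: perms_desc_def)
    define k where "k = inv w 1 - 1"
    have "inv w 1 \<in> {1..n}" using permutes_in_image[OF permutes_inv[OF perm], of 1] n by simp
    then have k: "k < n" "inv w 1 = k + 1" by (auto simp: k_def)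
    then have w1: "w (k + 1) = 1" using permutes_inverses(1)[OF perm, of 1] by simp
    have "k \<in> D" if "k \<noteq> 0"
    proof -
      have "w k \<in> {1..n}" using permutes_in_image[OF perm, of k] that k by simp
      moreover have "w k \<noteq> w (k + 1)" using permutes_inj[OF perm] by (simp add: inj_eq)
      ultimately have "w k > w (k + 1)" using w1 by simp
      then show ?thesis using w that k by (auto simp: perms_desc_def)
    qed
    then show ?thesis using k w1 by (auto simp: k_def)
  qed
  have iff: "inv w 1 - 1 = k \<longleftrightarrow> w (k + 1) = 1" if w: "w \<in> perms_desc n D" for w k
  proof
    show "w (k + 1) = 1" if "inv w 1 - 1 = k"
      using conjunct2[OF cov[OF w]] unfolding that .
    have "w permutes {1..n}" using w by (simp add: perms_desc_def)
    then show "inv w 1 - 1 = k" if "w (k + 1) = 1"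
      using permutes_inv_eq[of w "{1..n}" 1 "k + 1"] that by simp
  qed
  have img: "(\<lambda>w. inv w 1 - 1) ` perms_desc n D \<subseteq> ?K"
    by (rule image_subsetI) (rule conjunct1[OF cov])
  have "(\<Sum>w\<in>perms_desc n D. wt n w) =
      (\<Sum>k\<in>?K. \<Sum>w | w \<in> perms_desc n D \<and> inv w 1 - 1 = k. wt n w)"
    by (rule sum.group[OF finite_perms_desc _ img, symmetric]) simp
  also have "\<dots> = (\<Sum>k\<in>?K. \<Sum>w | w \<in> perms_desc n D \<and> w (k + 1) = 1. wt n w)"
    by (simp only: iff cong: conj_cong)
  finally show ?thesis
    using False n sum_perms_desc_at[of n _ D] by simp
qed

section \<open>Partial sums as descent sets\<close>

lemma psum_mono: "s \<le> s' \<Longrightarrow> psum \<alpha> s \<le> psum \<alpha> s'"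
  by (auto simp: psum_def take_add dest!: le_Suc_ex)

lemma psum_Suc: "s < length \<alpha> \<Longrightarrow> psum \<alpha> (Suc s) = psum \<alpha> s + \<alpha> ! s"
  by (simp add: psum_def take_Suc_conv_app_nth)

lemma psum_append:
  "psum (xs @ ys) s = (if s \<le> length xs then psum xs s else sum_list xs + psum ys (s - length xs))"
  by (auto simp: psum_def)

lemma psum_0: "psum \<alpha> 0 = 0"
  by (simp add: psum_def)

lemma psum_length: "psum \<alpha> (length \<alpha>) = sum_list \<alpha>"
  by (simp add: psum_def)

definition cuts :: "nat list \<Rightarrow> nat set" where
  "cuts \<alpha> = psum \<alpha> ` {1..<length \<alpha>}"

lemma min_coset_reps_eq: "min_coset_reps n \<alpha> = perms_desc n (cuts \<alpha>)"
  by (simp add: min_coset_reps_def perms_desc_def cuts_def)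

lemma perms_desc_cuts_pair: "perms_desc n {k} = perms_desc n (cuts [k, m])"
  by (simp add: cuts_def psum_def numeral_2_eq_2 lessThan_Suc atLeastLessThanSuc)

text \<open>
  Up to the start of a nonempty block, only the partial sums of the earlier blocks occur.
\<close>
lemma cuts_prefix:
  assumes "0 < m"
  shows "perms_desc (sum_list xs) (cuts (xs @ m # ys)) = perms_desc (sum_list xs) (cuts xs)"
proof (rule perms_desc_cong)
  fix i assume i: "1 \<le> i" "i < sum_list xs"
  show "i \<in> cuts (xs @ m # ys) \<longleftrightarrow> i \<in> cuts xs"
  proof
    assume "i \<in> cuts (xs @ m # ys)"
    then obtain s where s: "1 \<le> s" "i = psum (xs @ m # ys) s" by (auto simp: cuts_def)
    with i have "s < length xs"
      by (cases "s < length xs"; cases "s = length xs") (auto simp: psum_append psum_length)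
    then show "i \<in> cuts xs" using s by (auto simp: cuts_def psum_append)
  next
    assume "i \<in> cuts xs"
    then obtain s where s: "1 \<le> s" "s < length xs" "i = psum xs s" by (auto simp: cuts_def)
    then have "i = psum (xs @ m # ys) s" by (simp add: psum_append)
    then show "i \<in> cuts (xs @ m # ys)" using s by (auto simp: cuts_def)
  qed
qed

text \<open>
  The first place of the block \<open>m\<close> is occupied by the entry \<open>1\<close>. The blocks after it are those of
  \<open>ys\<close>, preceded by what is left of the block \<open>m\<close>.
\<close>
lemma cuts_suffix:
  assumes "0 < m"
  shows "perms_desc n {i. i + (sum_list xs + 1) \<in> cuts (xs @ m # ys)} =
    perms_desc n (cuts ((m - 1) # ys))"
proof (rule perms_desc_cong)
  fix i assume i: "1 \<le> i" "i < n"
  have shift: "psum (xs @ m # ys) (length xs + Suc t) = psum ((m - 1) # ys) (Suc t) + (sum_list xs + 1)"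
    for t using assms by (simp add: psum_append psum_Cons_Suc)
  show "i \<in> {i. i + (sum_list xs + 1) \<in> cuts (xs @ m # ys)} \<longleftrightarrow> i \<in> cuts ((m - 1) # ys)"
  proof
    assume "i \<in> {i. i + (sum_list xs + 1) \<in> cuts (xs @ m # ys)}"
    then obtain s where s: "s < length xs + Suc (length ys)"
      "i + (sum_list xs + 1) = psum (xs @ m # ys) s" by (auto simp: cuts_def)
    have "length xs < s"
    proof (rule ccontr)
      assume "\<not> length xs < s"
      then have "psum (xs @ m # ys) s \<le> psum (xs @ m # ys) (length xs)" by (intro psum_mono) simp
      then show False using s(2) by (simp add: psum_append psum_length)
    qed
    then obtain t where t: "s = length xs + Suc t" using less_imp_Suc_add by fastforce
    then have "i = psum ((m - 1) # ys) (Suc t)" using s(2) shift[of t] by simp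
    moreover have "Suc t \<in> {1..<length ((m - 1) # ys)}" using s(1) t by simp
    ultimately show "i \<in> cuts ((m - 1) # ys)" unfolding cuts_def by (rule image_eqI)
  next
    assume "i \<in> cuts ((m - 1) # ys)"
    then obtain s where s: "1 \<le> s" "s < Suc (length ys)" "i = psum ((m - 1) # ys) s"
      by (auto simp: cuts_def)
    then obtain t where t: "s = Suc t" by (cases s) auto
    have "i + (sum_list xs + 1) = psum (xs @ m # ys) (length xs + Suc t)"
      using shift[of t] s(3) t by simp
    moreover have "length xs + Suc t \<in> {1..<length (xs @ m # ys)}" using s t by simp
    ultimately show "i \<in> {i. i + (sum_list xs + 1) \<in> cuts (xs @ m # ys)}"
      unfolding cuts_def mem_Collect_eq by (rule image_eqI)
  qed
qed

text \<open>
  Blocks of length \<open>0\<close> start where the next nonempty block starts, so each starting position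
  belongs to exactly one nonempty block.
\<close>
lemma bij_betw_psum_cuts:
  "bij_betw (psum \<alpha>) {s. s < length \<alpha> \<and> 0 < \<alpha> ! s} {k. k < sum_list \<alpha> \<and> (k = 0 \<or> k \<in> cuts \<alpha>)}"
  (is "bij_betw _ ?S ?K")
  unfolding bij_betw_def
proof (intro conjI equalityI)
  have less: "psum \<alpha> s < psum \<alpha> s'" if "s \<in> ?S" "s < s'" for s s'
  proof -
    have "psum \<alpha> s < psum \<alpha> (Suc s)" using that(1) by (simp add: psum_Suc)
    also have "\<dots> \<le> psum \<alpha> s'" using that(2) by (intro psum_mono) simp
    finally show ?thesis .
  qed
  show "inj_on (psum \<alpha>) ?S"
    by (intro inj_onI) (metis less less_irrefl nat_neq_iff)
  show "psum \<alpha> ` ?S \<subseteq> ?K"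
  proof (rule image_subsetI)
    fix s assume s: "s \<in> ?S"
    then have "psum \<alpha> s < sum_list \<alpha>" using less[OF s, of "length \<alpha>"] by (simp add: psum_length)
    moreover have "psum \<alpha> s = 0 \<or> psum \<alpha> s \<in> cuts \<alpha>"
      using s by (cases "s = 0") (auto simp: cuts_def psum_0)
    ultimately show "psum \<alpha> s \<in> ?K" by simp
  qed
  show "?K \<subseteq> psum \<alpha> ` ?S"
  proof
    fix k assume "k \<in> ?K"
    then have k: "k < sum_list \<alpha>" and "k = 0 \<or> k \<in> cuts \<alpha>" by auto
    then obtain j where j: "k = psum \<alpha> j"
      using psum_0[of \<alpha>] by (metis cuts_def imageE)
    \<comment> \<open>The nonempty block that starts at \<open>k\<close> is the one whose end is the first partial sum beyond \<open>k\<close>.\<close>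
    define t where "t = (LEAST t. k < psum \<alpha> t)"
    have "k < psum \<alpha> (length \<alpha>)" using k by (simp add: psum_length)
    then have t: "k < psum \<alpha> t" "t \<le> length \<alpha>" unfolding t_def by (rule LeastI, rule Least_le)
    have "t \<noteq> 0" using t(1) by (intro notI) (simp add: psum_0)
    then obtain s where s: "t = Suc s" by (cases t) auto
    have le: "psum \<alpha> s \<le> k"
      using not_less_Least[of s "\<lambda>t. k < psum \<alpha> t"] s unfolding t_def by simp
    have "j \<le> s"
    proof (rule ccontr)
      assume "\<not> j \<le> s"
      then have "psum \<alpha> t \<le> psum \<alpha> j" unfolding s by (intro psum_mono) simp
      then show False using t(1) j by simp
    qed
    then have "k \<le> psum \<alpha> s" using psum_mono j by simp
    with le have ks: "k = psum \<alpha> s" by simp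
    then have "0 < \<alpha> ! s" using t s psum_Suc[of s \<alpha>] by simp
    then show "k \<in> psum \<alpha> ` ?S" using ks t(2) s by auto
  qed
qed

section \<open>The multinomial as a sum of weights\<close>

text \<open>
  The generalisation to lists with zeros that the induction needs. The induction
  hypothesis is used three times, for \<open>n - 1\<close>, \<open>k\<close> and \<open>n - k - 1\<close>.
\<close>
lemma qtmultinomial_eq_sum_wt:
  assumes "sum_list \<alpha> = n"
  shows "qtmultinomial n \<alpha> = (\<Sum>w\<in>perms_desc n (cuts \<alpha>). wt n w)"
  using assms
proof (induction n arbitrary: \<alpha> rule: less_induct)
  case (less n)
  show ?case
  proof (cases "n = 0")
    case True
    have "qtfact_comp \<alpha> = 1" if "\<forall>x\<in>set \<alpha>. x = 0"
      using that by (induction \<alpha>) (auto simp: qtfact_comp_Nil qtfact_comp_Cons qtfact_0)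
    then have "qtfact_comp \<alpha> = 1" using less.prems True by simp
    moreover have "perms_desc 0 (cuts \<alpha>) = {id}" by (auto simp: perms_desc_def)
    ultimately show ?thesis using True by (simp add: qtmultinomial_def qtfact_0 wt.simps)
  next
    case False
    define D where "D = cuts \<alpha>"
    define contrib where "contrib k = wt_coeff k * phi (\<Sum>u\<in>perms_desc (n - 1) {k}. wt (n - 1) u) *
      (\<Sum>a\<in>perms_desc k D. wt k a) *
      (phi ^^ (k + 1)) (\<Sum>c\<in>perms_desc (n - k - 1) {i. i + (k + 1) \<in> D}. wt (n - k - 1) c)" for k
    let ?ratio = "\<lambda>s. (tq (psum \<alpha> s) - tq (psum \<alpha> (Suc s))) / (tq 0 - tq n)"
    have contrib: "contrib (psum \<alpha> s) = qtmultinomial n \<alpha> * ?ratio s"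
      if s: "s < length \<alpha>" "0 < \<alpha> ! s" for s
    proof -
      define xs m ys where "xs = take s \<alpha>" and "m = \<alpha> ! s" and "ys = drop (Suc s) \<alpha>"
      have \<alpha>: "\<alpha> = xs @ m # ys" unfolding xs_def m_def ys_def by (rule id_take_nth_drop[OF s(1)])
      have m: "0 < m" using s by (simp add: m_def)
      define k where "k = sum_list xs"
      have k: "psum \<alpha> s = k" by (simp add: k_def xs_def psum_def)
      have n: "n = k + m + sum_list ys" using less.prems \<alpha> by (simp add: k_def)
      have "(\<Sum>u\<in>perms_desc (n - 1) {k}. wt (n - 1) u) = qtmultinomial (n - 1) [k, n - 1 - k]"
        using less.IH[of "n - 1" "[k, n - 1 - k]"] n m perms_desc_cuts_pair[of "n - 1" k "n - 1 - k"] by simp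
      moreover have "(\<Sum>a\<in>perms_desc k D. wt k a) = qtmultinomial k xs"
        using less.IH[of k xs] n m cuts_prefix[OF m, of xs ys] unfolding D_def \<alpha> k_def by simp
      moreover have "(\<Sum>c\<in>perms_desc (n - k - 1) {i. i + (k + 1) \<in> D}. wt (n - k - 1) c) =
          qtmultinomial (n - k - 1) ((m - 1) # ys)"
        using less.IH[of "n - k - 1" "(m - 1) # ys"] n m cuts_suffix[OF m, of "n - k - 1" xs ys]
        unfolding D_def \<alpha> k_def by simp
      ultimately have "contrib k = qtmultinomial n \<alpha> * ((tq k - tq (k + m)) / (tq 0 - tq n))"
        unfolding contrib_def \<alpha> by (simp only: qtmultinomial_split[OF k_def n m])
      then show ?thesis using psum_Suc[OF s(1)] k m_def by simp
    qed
    have "(\<Sum>w\<in>perms_desc n D. wt n w) = (\<Sum>k | k < n \<and> (k = 0 \<or> k \<in> D). contrib k)"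
      unfolding contrib_def using False by (intro sum_perms_desc_rec) simp
    also have "\<dots> = (\<Sum>s | s < length \<alpha> \<and> 0 < \<alpha> ! s. contrib (psum \<alpha> s))"
      using sum.reindex_bij_betw[OF bij_betw_psum_cuts[of \<alpha>], of "contrib"] less.prems by (simp add: D_def)
    also have "\<dots> = (\<Sum>s | s < length \<alpha> \<and> 0 < \<alpha> ! s. qtmultinomial n \<alpha> * ?ratio s)"
      by (intro sum.cong refl) (use contrib in auto)
    \<comment> \<open>Empty blocks have ratio \<open>0\<close>, so they can be added to complete the telescoping sum.\<close>
    also have "\<dots> = (\<Sum>s<length \<alpha>. qtmultinomial n \<alpha> * ?ratio s)"
      by (rule sum.mono_neutral_left) (auto simp: psum_Suc)
    also have "\<dots> = qtmultinomial n \<alpha> *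
        ((\<Sum>s<length \<alpha>. tq (psum \<alpha> s) - tq (psum \<alpha> (Suc s))) / (tq 0 - tq n))"
      by (simp only: sum_distrib_left sum_divide_distrib)
    also have "(\<Sum>s<length \<alpha>. tq (psum \<alpha> s) - tq (psum \<alpha> (Suc s))) = tq 0 - tq n"
      using sum_lessThan_telescope'[of "\<lambda>s. tq (psum \<alpha> s)" "length \<alpha>"] less.prems
      by (simp add: psum_0 psum_length)
    also have "(tq 0 - tq n) / (tq 0 - tq n) = 1"
      using False var_eq_iff[of "int 0" "int n"] by (intro divide_self) simp
    finally show ?thesis by (simp add: D_def)
  qed
qed

theorem theorem8p6:
  fixes n :: nat and \<alpha> :: "nat list"
  assumes "composition n \<alpha>"
  shows "qtmultinomial n \<alpha> = (\<Sum>w\<in>min_coset_reps n \<alpha>. wt n w)"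
  using assms qtmultinomial_eq_sum_wt[of \<alpha> n] by (simp add: composition_def min_coset_reps_eq)

end
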